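(* Let $\mathbb{K}$ be a field, let $d$ be a nonnegative integer, and let $p=(\{\theta_i\}_{i=0}^d;\{\theta^*_i\}_{i=0}^d)$ be a sequence of scalars taken from $\mathbb{K}$ that satisfies: (i) $\theta_i\neq\theta_j$ and $\theta^*_i\neq\theta^*_j$ if $i\neq j$ $(0\le i,j\le d)$; (ii) the expressions $\frac{\theta_{i-2}-\theta_{i+1}}{\theta_{i-1}-\theta_i}$ and $\frac{\theta^*_{i-2}-\theta^*_{i+1}}{\theta^*_{i-1}-\theta^*_i}$ are equal and independent of $i$ for $2\le i\le d-1$. Let $\mathbb{F}$ be a field extension of $\mathbb{K}$, and let $T_{\mathbb{K}}=T(p,\mathbb{K})$ and $T_{\mathbb{F}}=T(p,\mathbb{F})$ be the associated algebras. Let $$\mu_{\mathbb{K}}:\mathbb{K}[x_1,\ldots,x_d]\to e^*_0T_{\mathbb{K}}e^*_0,\qquad \mu_{\mathbb{F}}:\mathbb{F}[x_1,\ldots,x_d]\to e^*_0T_{\mathbb{F}}e^*_0$$ be the $\mathbb{K}$-algebra (resp. $\mathbb{F}$-algebra) homomorphisms that send $x_i\mapsto e^*_0\tau_i(a)e^*_0$ for $1\le i\le d$. Assume that $\mu_{\mathbb{F}}$ is an isomorphism. Then $\mu_{\mathbb{K}}$ is an isomorphism.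
   Context: For $0\le i\le d$, $\tau_i=(\lambda-\theta_0)(\lambda-\theta_1)\cdots(\lambda-\theta_{i-1})$, a polynomial in the indeterminate $\lambda$ (with $\tau_0=1$). The algebra $T(p,\mathbb{K})$. For a field $\mathbb{K}$ and $p=(\{\theta_i\}_{i=0}^d;\{\theta^*_i\}_{i=0}^d)$ with entries in $\mathbb{K}$ satisfying (i), (ii) of the claim, $T=T(p,\mathbb{K})$ is the associative $\mathbb{K}$-algebra with $1$ defined by generators $a$, $\{e_i\}_{i=0}^d$, $a^*$, $\{e^*_i\}_{i=0}^d$ and relations - $e_ie_j=\delta_{i,j}e_i$, $e^*_ie^*_j=\delta_{i,j}e^*_i$ $(0\le i,j\le d)$; - $1=\sum_{i=0}^d e_i$, $1=\sum_{i=0}^d e^*_i$; - $a=\sum_{i=0}^d\theta_ie_i$, $a^*=\sum_{i=0}^d\theta^*_ie^*_i$; - $e^*_ia^ke^*_j=0$ if $k<|i-j|$ $(0\le i,j,k\le d)$; - $e_i(a^* )^ke_j=0$ if $k<|i-j|$ $(0\le i,j,k\le d)$. (Here $a^*$, $e_i^*$ are just names of generators; no involution is intended.) The set $e^*_0Te^*_0$ is a $\mathbb{K}$-algebra with multiplicative identity $e^*_0$. It is known that $e^*_0Te^*_0$ is commutative and generated by $e^*_0\tau_i(a)e^*_0$ $(1\le i\le d)$; hence there is a (unique, surjective) $\mathbb{K}$-algebra homomorphism from the commutative polynomial algebra $\mathbb{K}[x_1,\ldots,x_d]$ to $e^*_0Te^*_0$ with $x_i\mapsto e^*_0\tau_i(a)e^*_0$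 for $1\le i\le d$. The same applies with $\mathbb{F}$ in place of $\mathbb{K}$, viewing the entries of $p$ as elements of $\mathbb{F}$. *)

theory Defs
  imports
    "HOL-Library.Poly_Mapping"
    "HOL-Computational_Algebra.Polynomial"
    "HOL-Algebra.QuotRing"
    "HOL-Algebra.Module"
begin

hide_const (open) Polynomial.smult

text \<open>
  Associative unital algebras over a field \<open>'k\<close> are HOL-Algebra records of type
  \<open>('k, 'x) module\<close>, i.e. rings with a scalar multiplication. (The library locale \<open>algebra\<close>
  is restricted to commutative algebras.)
\<close>

definition alg_hom ::
  "('k, 'x, 'm) module_scheme \<Rightarrow> ('k, 'y, 'n) module_scheme \<Rightarrow> ('x \<Rightarrow> 'y) set" where
  "alg_hom A B = {h \<in> ring_hom A B. \<forall>c. \<forall>x \<in> carrier A. h (c \<odot>\<^bsub>A\<^esub> x) = c \<odot>\<^bsub>B\<^esub> h x}"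

definition alg_iso ::
  "('k, 'x, 'm) module_scheme \<Rightarrow> ('k, 'y, 'n) module_scheme \<Rightarrow> ('x \<Rightarrow> 'y) set" where
  "alg_iso A B = {h \<in> alg_hom A B. bij_betw h (carrier A) (carrier B)}"

definition poly_eval :: "('k::zero, 'x, 'm) module_scheme \<Rightarrow> 'k poly \<Rightarrow> 'x \<Rightarrow> 'x" where
  "poly_eval A p x = (\<Oplus>\<^bsub>A\<^esub>k\<in>{..degree p}. coeff p k \<odot>\<^bsub>A\<^esub> (x [^]\<^bsub>A\<^esub> k))"

text \<open>The scalar multiplication on cosets is defined in the same way as \<^const>\<open>rcoset_mult\<close>.\<close>

definition quot_alg :: "('k, 'x, 'm) module_scheme \<Rightarrow> 'x set \<Rightarrow> ('k, 'x set) module" where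
  "quot_alg A I =
    ring.extend (A Quot I) (module.fields (\<lambda>c X. \<Union>x\<in>X. I +>\<^bsub>A\<^esub> (c \<odot>\<^bsub>A\<^esub> x)))"

text \<open>The corner \<open>e A e\<close> of an algebra at an idempotent \<open>e\<close>, with multiplicative identity \<open>e\<close>.\<close>

definition corner :: "('k, 'x, 'm) module_scheme \<Rightarrow> 'x \<Rightarrow> ('k, 'x, 'm) module_scheme" where
  "corner A e = A\<lparr>carrier := {e \<otimes>\<^bsub>A\<^esub> x \<otimes>\<^bsub>A\<^esub> e | x. x \<in> carrier A}, one := e\<rparr>"

text \<open>
  The monoid algebra of a submonoid \<open>M\<close> of an additively written monoid. With exponent
  functions as monomials it is a polynomial algebra, with words it is a free algebra.
\<close>

definition monoid_alg ::
  "'m::monoid_add set \<Rightarrow> ('k::field, 'm \<Rightarrow>\<^sub>0 'k) module" where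
  "monoid_alg M =
    \<lparr>carrier = {f. Poly_Mapping.keys f \<subseteq> M}, mult = (*), one = 1, zero = 0, add = (+),
     smult = (\<lambda>c f. Poly_Mapping.single 0 c * f)\<rparr>"

definition poly_alg :: "nat \<Rightarrow> ('k::field, (nat \<Rightarrow>\<^sub>0 nat) \<Rightarrow>\<^sub>0 'k) module" where
  "poly_alg d = monoid_alg {m. Poly_Mapping.keys m \<subseteq> {1..d}}"

definition pvar :: "nat \<Rightarrow> (nat \<Rightarrow>\<^sub>0 nat) \<Rightarrow>\<^sub>0 'k::field" where
  "pvar i = Poly_Mapping.single (Poly_Mapping.single i 1) 1"

datatype 'g word = Word (letters: "'g list")

instantiation word :: (type) monoid_add
begin
definition zero_word :: "'a word" where "0 = Word []"
definition plus_word :: "'a word \<Rightarrow> 'a word \<Rightarrow> 'a word" where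
  "v + w = Word (letters v @ letters w)"
instance by standard (simp_all add: zero_word_def plus_word_def)
end

definition free_alg :: "'g set \<Rightarrow> ('k::field, 'g word \<Rightarrow>\<^sub>0 'k) module" where
  "free_alg G = monoid_alg {w. set (letters w) \<subseteq> G}"

definition letter :: "'g \<Rightarrow> 'g word \<Rightarrow>\<^sub>0 'k::field" where
  "letter g = Poly_Mapping.single (Word [g]) 1"

abbreviation scalar :: "'k::field \<Rightarrow> 'g word \<Rightarrow>\<^sub>0 'k" where
  "scalar c \<equiv> Poly_Mapping.single 0 c"

text \<open>
  The generators \<open>a\<close>, \<open>e\<^sub>i\<close>, \<open>a\<^sup>*\<close>, \<open>e\<^sup>*\<^sub>i\<close>; only the indices \<open>i \<le> d\<close> are used. Throughout, \<open>\<theta>\<close>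
  and \<open>\<theta>s\<close> are the sequences \<open>\<theta>\<^sub>i\<close> and \<open>\<theta>\<^sup>*\<^sub>i\<close>, which are only evaluated at indices up to \<open>d\<close>.
\<close>

datatype generator = A | E nat | As | Es nat

definition T_gens :: "nat \<Rightarrow> generator set" where
  "T_gens d = {A, As} \<union> E ` {..d} \<union> Es ` {..d}"

text \<open>Each relation \<open>l = r\<close> is represented by the element \<open>l - r\<close> of the free algebra.\<close>

definition T_rels ::
  "nat \<Rightarrow> (nat \<Rightarrow> 'k::field) \<Rightarrow> (nat \<Rightarrow> 'k) \<Rightarrow> (generator word \<Rightarrow>\<^sub>0 'k) set" where
  "T_rels d \<theta> \<theta>s =
    {letter (E i) * letter (E j) - (if i = j then letter (E i) else 0) | i j. i \<le> d \<and> j \<le> d} \<union>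
    {letter (Es i) * letter (Es j) - (if i = j then letter (Es i) else 0) | i j. i \<le> d \<and> j \<le> d} \<union>
    {1 - (\<Sum>i\<le>d. letter (E i)), 1 - (\<Sum>i\<le>d. letter (Es i))} \<union>
    {letter A - (\<Sum>i\<le>d. scalar (\<theta> i) * letter (E i)),
     letter As - (\<Sum>i\<le>d. scalar (\<theta>s i) * letter (Es i))} \<union>
    {letter (Es i) * letter A ^ k * letter (Es j) | i j k.
      i \<le> d \<and> j \<le> d \<and> k \<le> d \<and> int k < \<bar>int i - int j\<bar>} \<union>
    {letter (E i) * letter As ^ k * letter (E j) | i j k.
      i \<le> d \<and> j \<le> d \<and> k \<le> d \<and> int k < \<bar>int i - int j\<bar>}"

definition T_ideal ::
  "nat \<Rightarrow> (nat \<Rightarrow> 'k::field) \<Rightarrow> (nat \<Rightarrow> 'k) \<Rightarrow> (generator word \<Rightarrow>\<^sub>0 'k) set" where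
  "T_ideal d \<theta> \<theta>s = Idl\<^bsub>free_alg (T_gens d)\<^esub> (T_rels d \<theta> \<theta>s)"

definition T_alg ::
  "nat \<Rightarrow> (nat \<Rightarrow> 'k::field) \<Rightarrow> (nat \<Rightarrow> 'k) \<Rightarrow> ('k, (generator word \<Rightarrow>\<^sub>0 'k) set) module" where
  "T_alg d \<theta> \<theta>s = quot_alg (free_alg (T_gens d)) (T_ideal d \<theta> \<theta>s)"

definition T_gen ::
  "nat \<Rightarrow> (nat \<Rightarrow> 'k::field) \<Rightarrow> (nat \<Rightarrow> 'k) \<Rightarrow> generator \<Rightarrow> (generator word \<Rightarrow>\<^sub>0 'k) set" where
  "T_gen d \<theta> \<theta>s g = T_ideal d \<theta> \<theta>s +>\<^bsub>free_alg (T_gens d)\<^esub> letter g"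

definition corner_T ::
  "nat \<Rightarrow> (nat \<Rightarrow> 'k::field) \<Rightarrow> (nat \<Rightarrow> 'k) \<Rightarrow> ('k, (generator word \<Rightarrow>\<^sub>0 'k) set) module" where
  "corner_T d \<theta> \<theta>s = corner (T_alg d \<theta> \<theta>s) (T_gen d \<theta> \<theta>s (Es 0))"

definition tau :: "(nat \<Rightarrow> 'k::field) \<Rightarrow> nat \<Rightarrow> 'k poly" where
  "tau \<theta> i = (\<Prod>h<i. [:- \<theta> h, 1:])"

text \<open>The element \<open>e\<^sup>*\<^sub>0 \<tau>\<^sub>i(a) e\<^sup>*\<^sub>0\<close> of \<open>T\<close>.\<close>

definition corner_tau ::
  "nat \<Rightarrow> (nat \<Rightarrow> 'k::field) \<Rightarrow> (nat \<Rightarrow> 'k) \<Rightarrow> nat \<Rightarrow> (generator word \<Rightarrow>\<^sub>0 'k) set" where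
  "corner_tau d \<theta> \<theta>s i =
    T_gen d \<theta> \<theta>s (Es 0) \<otimes>\<^bsub>T_alg d \<theta> \<theta>s\<^esub>
    poly_eval (T_alg d \<theta> \<theta>s) (tau \<theta> i) (T_gen d \<theta> \<theta>s A) \<otimes>\<^bsub>T_alg d \<theta> \<theta>s\<^esub>
    T_gen d \<theta> \<theta>s (Es 0)"

definition field_embedding :: "('k::field \<Rightarrow> 'f::field) \<Rightarrow> bool" where
  "field_embedding \<iota> \<longleftrightarrow>
    \<iota> 1 = 1 \<and> (\<forall>x y. \<iota> (x + y) = \<iota> x + \<iota> y) \<and> (\<forall>x y. \<iota> (x * y) = \<iota> x * \<iota> y)"

end

theory Submission
  imports Defs
begin

text \<open>
  Faithfully flat descent along \<open>K \<rightarrow> F\<close>, with the tensor product replaced by a \<open>K\<close>-linear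
  retraction \<open>\<pi>\<close> of the embedding \<open>\<iota>\<close>. Applied coefficientwise, \<open>\<iota>\<close> maps the ideal of
  relations over \<open>K\<close> into the one over \<open>F\<close>; since the latter is spanned over \<open>F\<close> by the
  products \<open>v r w\<close> with words \<open>v\<close>, \<open>w\<close> and relations \<open>r\<close> with coefficients in \<open>K\<close>, \<open>\<pi>\<close> maps it
  back. The induced maps \<open>T\<^sub>K \<rightarrow> T\<^sub>F \<rightarrow> T\<^sub>K\<close> compose to the identity and are compatible with
  \<open>\<mu>\<^sub>K\<close> and \<open>\<mu>\<^sub>F\<close>, because both send a monomial to the class of the same element of the free
  algebra over \<open>K\<close>. So \<open>\<mu>\<^sub>K\<close> is a retract of \<open>\<mu>\<^sub>F\<close>, and inherits injectivity and surjectivity.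
\<close>

section \<open>Monoid algebras\<close>

lemma poly_mapping_sum_single:
  fixes f :: "'a \<Rightarrow>\<^sub>0 'b::comm_monoid_add"
  shows "f = (\<Sum>k\<in>Poly_Mapping.keys f. Poly_Mapping.single k (Poly_Mapping.lookup f k))"
  by (rule poly_mapping_eqI)
    (auto simp: lookup_sum lookup_single when_def in_keys_iff intro: sum.neutral)

text \<open>A finitely supported function is the finite sum of its single terms, so induction over
  the finite subsets of its support suffices. The rule serves elements of monoid algebras and, with
  values in nat, exponent vectors.\<close>

lemma keys_subset_induct [consumes 1, case_names zero single add]:
  fixes f :: "'a \<Rightarrow>\<^sub>0 'b::comm_monoid_add"
  assumes "Poly_Mapping.keys f \<subseteq> M"
    and zero: "P 0"
    and single: "\<And>m c. m \<in> M \<Longrightarrow> P (Poly_Mapping.single m c)"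
    and add: "\<And>g h. Poly_Mapping.keys g \<subseteq> M \<Longrightarrow> Poly_Mapping.keys h \<subseteq> M \<Longrightarrow> P g \<Longrightarrow> P h \<Longrightarrow> P (g + h)"
  shows "P f"
proof -
  let ?s = "\<lambda>S. \<Sum>k\<in>S. Poly_Mapping.single k (Poly_Mapping.lookup f k)"
  have "finite S \<Longrightarrow> S \<subseteq> M \<Longrightarrow> Poly_Mapping.keys (?s S) \<subseteq> M \<and> P (?s S)" for S
  proof (induction S rule: finite_induct)
    case empty
    then show ?case by (simp add: zero)
  next
    case (insert k S)
    have 1: "Poly_Mapping.keys (Poly_Mapping.single k (Poly_Mapping.lookup f k)) \<subseteq> M"
      using insert.prems by auto
    with insert have "Poly_Mapping.keys (?s (insert k S)) \<subseteq> M"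
      using Poly_Mapping.keys_add[of "Poly_Mapping.single k (Poly_Mapping.lookup f k)" "?s S"]
      by auto
    then show ?case
      using insert 1 by (simp add: add single)
  qed
  from this[of "Poly_Mapping.keys f"] show ?thesis
    using assms(1) poly_mapping_sum_single[of f] by auto
qed

locale add_submonoid =
  fixes M :: "'m::monoid_add set"
  assumes zero_mem: "0 \<in> M"
    and add_mem: "a \<in> M \<Longrightarrow> b \<in> M \<Longrightarrow> a + b \<in> M"
begin

lemma keys_mult_subset:
  fixes f g :: "'m \<Rightarrow>\<^sub>0 'k::field"
  assumes "Poly_Mapping.keys f \<subseteq> M" "Poly_Mapping.keys g \<subseteq> M"
  shows "Poly_Mapping.keys (f * g) \<subseteq> M"
  using keys_mult[of f g] assms add_mem by blast

lemma ring_monoid_alg: "ring (monoid_alg M :: ('k::field, 'm \<Rightarrow>\<^sub>0 'k) module)"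
proof (rule ringI)
  show "abelian_group (monoid_alg M :: ('k, 'm \<Rightarrow>\<^sub>0 'k) module)"
  proof (rule abelian_groupI)
    show "\<exists>y\<in>carrier (monoid_alg M). y \<oplus>\<^bsub>monoid_alg M\<^esub> x = \<zero>\<^bsub>monoid_alg M\<^esub>"
      if "x \<in> carrier (monoid_alg M)" for x :: "'m \<Rightarrow>\<^sub>0 'k"
      using that by (intro bexI[of _ "- x"]) (auto simp: monoid_alg_def in_keys_iff)
  qed (use Poly_Mapping.keys_add in \<open>fastforce simp: monoid_alg_def algebra_simps\<close>)+
  show "Group.monoid (monoid_alg M :: ('k, 'm \<Rightarrow>\<^sub>0 'k) module)"
    by unfold_locales (auto simp: monoid_alg_def mult.assoc zero_mem keys_mult_subset[THEN subsetD])
qed (auto simp: monoid_alg_def algebra_simps)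

sublocale monoid_alg: ring "monoid_alg M :: ('k::field, 'm \<Rightarrow>\<^sub>0 'k) module"
  by (rule ring_monoid_alg)

lemma monoid_alg_minus:
  assumes "g \<in> carrier (monoid_alg M)"
  shows "f \<ominus>\<^bsub>monoid_alg M\<^esub> g = f - g"
proof -
  have "\<ominus>\<^bsub>monoid_alg M\<^esub> g = - g"
    by (rule monoid_alg.minus_equality[OF _ assms])
      (use assms in \<open>auto simp: monoid_alg_def in_keys_iff\<close>)
  then show ?thesis by (simp add: a_minus_def) (simp add: monoid_alg_def)
qed

lemma monoid_alg_pow: "f [^]\<^bsub>monoid_alg M\<^esub> (n::nat) = f ^ n"
  by (induction n) (auto simp: monoid_alg_def power_commutes)

lemma monoid_alg_finsum:
  assumes "finite S" "f \<in> S \<rightarrow> carrier (monoid_alg M :: ('k::field, 'm \<Rightarrow>\<^sub>0 'k) module)"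
  shows "finsum (monoid_alg M) f S = sum f S"
  using assms
proof (induction S rule: finite_induct)
  case (insert x S)
  then have "finsum (monoid_alg M) f (insert x S) = f x \<oplus>\<^bsub>monoid_alg M\<^esub> sum f S"
    by (subst monoid_alg.finsum_insert) auto
  with insert show ?case by (simp add: monoid_alg_def)
next
  case empty
  show ?case using monoid_alg.finsum_empty[of f] by (simp add: monoid_alg_def)
qed

end

section \<open>Quotient algebras\<close>

text \<open>Scalars act as left multiplication by the elements \<open>c \<odot> \<one>\<close>, so
  every ring ideal is stable under them and the quotient inherits the scalar action.\<close>

locale algebra_ideal = ideal I R for I and R :: "('k::zero, 'x, 'm) module_scheme" (structure) +
  assumes smult_one_closed: "c \<odot> \<one> \<in> carrier R"
    and smult_eq_mult: "x \<in> carrier R \<Longrightarrow> c \<odot> x = (c \<odot> \<one>) \<otimes> x"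
begin

lemma smult_closed: "x \<in> carrier R \<Longrightarrow> c \<odot> x \<in> carrier R"
  by (subst smult_eq_mult) (auto intro: smult_one_closed)

text \<open>The union defining the scalar action collapses: \<open>c \<odot> y\<close> is a product
  with \<open>c \<odot> \<one>\<close>, and products of cosets do not depend on the representative
  \<open>y\<close>.\<close>

lemma quot_alg_smult:
  assumes "x \<in> carrier R"
  shows "c \<odot>\<^bsub>quot_alg R I\<^esub> (I +> x) = I +> (c \<odot> x)"
proof -
  have "I +> (c \<odot> y) = I +> (c \<odot> x)" if "y \<in> I +> x" for y
  proof -
    have y: "y \<in> carrier R" using that assms a_r_coset_subset_G[OF a_subset] by blast
    have "I +> y = I +> x"
      using a_repr_independence[OF that assms a_subgroup] by simp
    then show ?thesis
      using rcoset_mult_add[OF smult_one_closed y] rcoset_mult_add[OF smult_one_closed assms]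
      by (simp add: smult_eq_mult[OF y, of c] smult_eq_mult[OF assms, of c])
  qed
  moreover have "x \<in> I +> x" by (rule a_rcos_self[OF assms])
  ultimately have "(\<Union>y\<in>I +> x. I +> (c \<odot> y)) = I +> (c \<odot> x)" by blast
  then show ?thesis by (simp add: quot_alg_def ring.extend_def module.fields_def)
qed

lemma ring_quot_alg: "ring (quot_alg R I)"
proof -
  interpret Q: ring "R Quot I" by (rule quotient_is_ring)
  \<comment> \<open>\<open>quot_alg R I\<close> and \<open>R Quot I\<close> are records of different
    types, so the ring axioms are carried over through the agreement of the operations.\<close>
  have simps: "carrier (quot_alg R I) = carrier (R Quot I)" "mult (quot_alg R I) = mult (R Quot I)"
    "one (quot_alg R I) = one (R Quot I)" "zero (quot_alg R I) = zero (R Quot I)"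
    "add (quot_alg R I) = add (R Quot I)"
    by (simp_all add: quot_alg_def ring.extend_def)
  show ?thesis
  proof (rule ringI)
    show "abelian_group (quot_alg R I)"
      by (rule abelian_groupI)
        (auto simp: simps Q.a_ac intro: Q.l_neg Q.a_inv_closed)
    show "Group.monoid (quot_alg R I)"
      by unfold_locales (auto simp: simps Q.m_assoc)
  qed (auto simp: simps Q.l_distr Q.r_distr)
qed

lemma rcos_ring_hom_quot_alg: "ring_hom_ring R (quot_alg R I) ((+>) I)"
proof (rule ring_hom_ringI2[OF ring_axioms ring_quot_alg])
  show "(+>) I \<in> ring_hom R (quot_alg R I)"
    using rcos_ring_hom unfolding ring_hom_def by (simp add: quot_alg_def ring.extend_def)
qed

lemma quot_alg_carrierE:
  assumes "X \<in> carrier (quot_alg R I)"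
  obtains x where "x \<in> carrier R" "X = I +> x"
  using assms by (auto simp: quot_alg_def ring.extend_def FactRing_simps)

lemma poly_eval_quot_alg:
  assumes "x \<in> carrier R"
  shows "poly_eval (quot_alg R I) p (I +> x) = I +> poly_eval R p x"
proof -
  interpret h: ring_hom_ring R "quot_alg R I" "(+>) I" by (rule rcos_ring_hom_quot_alg)
  have hom_finsum: "I +> finsum R f S = (\<Oplus>\<^bsub>quot_alg R I\<^esub>k\<in>S. I +> f k)"
    if "finite S" "f \<in> S \<rightarrow> carrier R" for f :: "nat \<Rightarrow> 'x" and S
    using that by (induction S rule: finite_induct) (auto simp: Pi_def)
  have "I +> poly_eval R p x
      = (\<Oplus>\<^bsub>quot_alg R I\<^esub>k\<in>{..degree p}. I +> (coeff p k \<odot> x [^] k))"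
    unfolding poly_eval_def using assms
    by (intro hom_finsum) (auto intro: smult_closed)
  also have "\<dots> = poly_eval (quot_alg R I) p (I +> x)"
    unfolding poly_eval_def using assms
    by (intro h.S.finsum_cong')
      (auto simp: quot_alg_smult h.hom_nat_pow[symmetric] smult_closed)
  finally show ?thesis by simp
qed

end

section \<open>Change of coefficients\<close>

text \<open>\<open>Poly_Mapping.map\<close> applies \<open>f\<close> on the support only;
  \<open>f 0 = 0\<close> extends the pointwise formula to all keys.\<close>

lemma lookup_map_zero:
  assumes "f 0 = 0"
  shows "Poly_Mapping.lookup (Poly_Mapping.map f p) k = f (Poly_Mapping.lookup p k)"
  using assms by (cases "Poly_Mapping.lookup p k = 0") (simp_all add: Poly_Mapping.map.rep_eq)

lemma keys_map_subset: "Poly_Mapping.keys (Poly_Mapping.map f p) \<subseteq> Poly_Mapping.keys p"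
  by (auto simp: in_keys_iff Poly_Mapping.map.rep_eq when_def)

text \<open>Additivity is what \<iota> and \<pi> have in common; \<pi> need not be
  multiplicative.\<close>

locale additive_map =
  fixes f :: "'a::ab_group_add \<Rightarrow> 'b::ab_group_add"
  assumes add: "f (x + y) = f x + f y"
begin

lemma zero [simp]: "f 0 = 0"
  using add[of 0 0] by simp

lemma map_zero [simp]: "Poly_Mapping.map f 0 = 0"
  by (rule poly_mapping_eqI) (simp add: lookup_map_zero)

lemma map_single [simp]: "Poly_Mapping.map f (Poly_Mapping.single k c) = Poly_Mapping.single k (f c)"
  by (rule poly_mapping_eqI) (simp add: lookup_map_zero lookup_single when_def)

lemma map_add: "Poly_Mapping.map f (p + q) = Poly_Mapping.map f p + Poly_Mapping.map f q"
  by (rule poly_mapping_eqI) (simp add: lookup_map_zero lookup_add add)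

lemma map_uminus: "Poly_Mapping.map f (- p) = - Poly_Mapping.map f p"
  using map_add[of p "- p"] by (simp add: eq_neg_iff_add_eq_0 add.commute)

lemma map_diff: "Poly_Mapping.map f (p - q) = Poly_Mapping.map f p - Poly_Mapping.map f q"
  using map_add[of p "- q"] by (simp add: map_uminus)

lemma map_sum: "Poly_Mapping.map f (sum g S) = (\<Sum>x\<in>S. Poly_Mapping.map f (g x))"
  by (induction S rule: infinite_finite_induct) (simp_all add: map_add)

end

section \<open>Field embeddings with a linear retraction\<close>

locale field_retraction =
  fixes \<iota> :: "'k::field \<Rightarrow> 'f::field" and \<pi> :: "'f \<Rightarrow> 'k"
  assumes embedding: "field_embedding \<iota>"
    and retract_add: "\<pi> (x + y) = \<pi> x + \<pi> y"
    and retract_mult: "\<pi> (\<iota> c * x) = c * \<pi> x"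
    and retract: "\<pi> (\<iota> c) = c"
begin

lemma embed_add: "\<iota> (x + y) = \<iota> x + \<iota> y" and embed_mult: "\<iota> (x * y) = \<iota> x * \<iota> y"
  and embed_one [simp]: "\<iota> 1 = 1"
  using embedding by (auto simp: field_embedding_def)

sublocale embed: additive_map \<iota>
  by unfold_locales (rule embed_add)

sublocale retract: additive_map \<pi>
  by unfold_locales (rule retract_add)

lemma embed_uminus: "\<iota> (- x) = - \<iota> x"
  using embed_add[of x "- x"] by (simp add: eq_neg_iff_add_eq_0 add.commute)

lemma embed_diff: "\<iota> (x - y) = \<iota> x - \<iota> y"
  using embed_add[of x "- y"] by (simp add: embed_uminus)

lemma embed_eq_iff: "\<iota> x = \<iota> y \<longleftrightarrow> x = y"
  by (metis retract)

lemma map_retract_embed [simp]: "Poly_Mapping.map \<pi> (Poly_Mapping.map \<iota> p) = p"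
  by (rule poly_mapping_eqI) (simp add: lookup_map_zero retract)

lemma map_embed_one [simp]: "Poly_Mapping.map \<iota> 1 = 1"
  using embed.map_single[of 0 1] by simp

text \<open>Both sides are additive in each factor, so it suffices to compare them on monomials:
  first in \<open>q\<close> with a monomial on the left, then in \<open>p\<close>.\<close>

lemma map_embed_mult:
  "Poly_Mapping.map \<iota> (p * q) = Poly_Mapping.map \<iota> p * Poly_Mapping.map \<iota> q"
  for p q :: "'m::monoid_add \<Rightarrow>\<^sub>0 'k"
proof -
  have "Poly_Mapping.map \<iota> (Poly_Mapping.single k c * q)
      = Poly_Mapping.single k (\<iota> c) * Poly_Mapping.map \<iota> q" for k c
    using subset_UNIV[of "Poly_Mapping.keys q"]
    by (induction q rule: keys_subset_induct)
      (simp_all add: mult_single embed_mult embed.map_add algebra_simps)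
  with subset_UNIV[of "Poly_Mapping.keys p"] show ?thesis
    by (induction p rule: keys_subset_induct) (simp_all add: embed.map_add algebra_simps)
qed

lemma map_embed_power: "Poly_Mapping.map \<iota> (p ^ n) = Poly_Mapping.map \<iota> p ^ n"
  for p :: "'m::monoid_add \<Rightarrow>\<^sub>0 'k"
  by (induction n) (simp_all add: map_embed_mult)

text \<open>The substitute for multiplicativity of \<pi>: every coefficient of the product is
  \<open>b * c\<close> times some \<open>\<iota> x\<close>, and K-linearity pulls \<open>x\<close>
  out of \<pi>. The right factor thereby keeps coefficient 1.\<close>

lemma map_retract_mult:
  "Poly_Mapping.map \<pi> (Poly_Mapping.single v b * Poly_Mapping.map \<iota> p * Poly_Mapping.single w c)
    = Poly_Mapping.single v (\<pi> (b * c)) * p * Poly_Mapping.single w 1"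
  for p :: "'m::monoid_add \<Rightarrow>\<^sub>0 'k"
  using subset_UNIV[of "Poly_Mapping.keys p"]
proof (induction p rule: keys_subset_induct)
  case (single m x)
  have "\<pi> (b * \<iota> x * c) = \<pi> (b * c) * x"
    using retract_mult[of x "b * c"] by (simp add: ac_simps)
  then show ?case by (simp add: mult_single)
qed (simp_all add: embed.map_add retract.map_add algebra_simps)

lemma map_retract_mult_left:
  "Poly_Mapping.map \<pi> (Poly_Mapping.single v b * Poly_Mapping.map \<iota> p)
    = Poly_Mapping.single v (\<pi> b) * p"
  for p :: "'m::monoid_add \<Rightarrow>\<^sub>0 'k"
  using map_retract_mult[of v b p 0 1] by simp

end

text \<open>An injective linear map between vector spaces has a linear left inverse; this is applied
  to \<iota> as a map of K-vector spaces.\<close>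

lemma field_retraction_exists:
  assumes "field_embedding \<iota>"
  obtains \<pi> where "field_retraction \<iota> \<pi>"
proof -
  have \<iota>: "\<iota> 1 = 1" "\<And>x y. \<iota> (x + y) = \<iota> x + \<iota> y" "\<And>x y. \<iota> (x * y) = \<iota> x * \<iota> y"
    using assms by (auto simp: field_embedding_def)
  then have \<iota>0: "\<iota> 0 = 0" by (metis add_cancel_right_left)
  \<comment> \<open>K acts on F through \<iota>.\<close>
  interpret vector_space_pair "(*) :: 'a \<Rightarrow> 'a \<Rightarrow> 'a" "\<lambda>c x. \<iota> c * x"
    by unfold_locales (simp_all add: \<iota> algebra_simps)
  have "Vector_Spaces.linear (*) (\<lambda>c x. \<iota> c * x) \<iota>"
    by unfold_locales (simp_all add: \<iota>)
  \<comment> \<open>If \<iota> identified two distinct elements, their difference would be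
    invertible with image 0, forcing 0 = 1 in F.\<close>
  moreover have "inj \<iota>"
  proof (rule injI, rule ccontr)
    fix x y assume eq: "\<iota> x = \<iota> y" and "x \<noteq> y"
    then have "\<iota> ((x - y) * inverse (x - y)) = 1" using \<iota>(1) by simp
    moreover have "\<iota> (x - y) = 0" using \<iota>(2)[of "x - y" y] eq by simp
    ultimately show False by (simp add: \<iota>)
  qed
  ultimately obtain \<pi> where \<pi>: "Vector_Spaces.linear (\<lambda>c x. \<iota> c * x) (*) \<pi>" "\<pi> \<circ> \<iota> = id"
    using linear_injective_left_inverse by blast
  interpret \<pi>: Vector_Spaces.linear "\<lambda>c x. \<iota> c * x" "(*)" \<pi> by fact
  have "field_retraction \<iota> \<pi>"
    by unfold_locales (use assms \<pi>(2) \<pi>.add \<pi>.scale in \<open>auto simp: fun_eq_iff\<close>)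
  then show ?thesis by (rule that)
qed

section \<open>The algebra \<open>T\<close>\<close>

lemma add_submonoid_words: "add_submonoid {w. set (letters w) \<subseteq> G}"
  by unfold_locales (auto simp: zero_word_def plus_word_def)

abbreviation exponents :: "nat \<Rightarrow> (nat \<Rightarrow>\<^sub>0 nat) set" where
  "exponents d \<equiv> {m. Poly_Mapping.keys m \<subseteq> {1..d}}"

abbreviation T_words :: "nat \<Rightarrow> generator word set" where
  "T_words d \<equiv> {w. set (letters w) \<subseteq> T_gens d}"

context
  fixes d :: nat
begin

interpretation words: add_submonoid "T_words d"
  by (rule add_submonoid_words)

text \<open>Left polymorphic in the field, so that the lemmas of this context apply over both K and
  F.\<close>

abbreviation (input) T_free :: "('k::field, generator word \<Rightarrow>\<^sub>0 'k) module" where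
  "T_free \<equiv> free_alg (T_gens d)"

lemma free_alg_simps:
  "carrier T_free = {f. Poly_Mapping.keys f \<subseteq> T_words d}" "mult T_free = (*)" "one T_free = 1" "zero T_free = 0"
  "add T_free = (+)" "smult T_free = (\<lambda>c f. Poly_Mapping.single 0 c * f)"
  by (simp_all add: free_alg_def monoid_alg_def)

lemma free_alg_ring: "ring (T_free :: ('k::field, _) module)"
  unfolding free_alg_def by (rule words.ring_monoid_alg)

lemma free_alg_closed:
  fixes x y :: "generator word \<Rightarrow>\<^sub>0 'k::field"
  shows "x \<in> carrier T_free \<Longrightarrow> y \<in> carrier T_free \<Longrightarrow> x + y \<in> carrier T_free"
    "x \<in> carrier T_free \<Longrightarrow> y \<in> carrier T_free \<Longrightarrow> x - y \<in> carrier T_free"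
    "x \<in> carrier T_free \<Longrightarrow> y \<in> carrier T_free \<Longrightarrow> x * y \<in> carrier T_free"
    "x \<in> carrier T_free \<Longrightarrow> x ^ n \<in> carrier T_free"
    "0 \<in> carrier T_free" "1 \<in> carrier T_free"
    "w \<in> T_words d \<Longrightarrow> Poly_Mapping.single w c \<in> carrier T_free"
    "scalar c \<in> carrier T_free"
    "g \<in> T_gens d \<Longrightarrow> letter g \<in> carrier T_free"
proof -
  show add: "x + y \<in> carrier T_free" if "x \<in> carrier T_free" "y \<in> carrier T_free" for x y
    using that Poly_Mapping.keys_add[of x y] by (auto simp: free_alg_simps)
  show "x - y \<in> carrier T_free" if "x \<in> carrier T_free" "y \<in> carrier T_free"
    using add[of x "- y"] that by (auto simp: free_alg_simps in_keys_iff)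
  show mult: "x * y \<in> carrier T_free" if "x \<in> carrier T_free" "y \<in> carrier T_free" for x y
    using that words.keys_mult_subset[of x y] by (auto simp: free_alg_simps)
  show one: "1 \<in> carrier T_free" "0 \<in> carrier T_free"
    by (auto simp: free_alg_simps zero_word_def)
  show "x ^ n \<in> carrier T_free" if "x \<in> carrier T_free"
    by (induction n) (auto simp: one mult that)
qed (auto simp: free_alg_simps letter_def zero_word_def)

lemma free_alg_sum_closed:
  "(\<And>i. i \<in> S \<Longrightarrow> f i \<in> carrier T_free) \<Longrightarrow> sum f S \<in> carrier T_free"
  by (induction S rule: infinite_finite_induct) (auto intro: free_alg_closed)

lemma T_gens_mem: "A \<in> T_gens d" "As \<in> T_gens d" "i \<le> d \<Longrightarrow> E i \<in> T_gens d"
  "i \<le> d \<Longrightarrow> Es i \<in> T_gens d"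
  by (auto simp: T_gens_def)

lemma T_rels_carrier: "T_rels d \<theta> \<theta>s \<subseteq> carrier T_free"
  unfolding T_rels_def
  by (auto intro!: free_alg_closed free_alg_sum_closed T_gens_mem)

lemma T_ideal_algebra_ideal:
  "algebra_ideal (T_ideal d \<theta> \<theta>s) (T_free :: ('k::field, _) module)"
proof (intro algebra_ideal.intro algebra_ideal_axioms.intro)
  show "ideal (T_ideal d \<theta> \<theta>s) (T_free :: ('k::field, _) module)"
    unfolding T_ideal_def by (rule ring.genideal_ideal[OF free_alg_ring T_rels_carrier])
qed (auto intro: free_alg_closed simp: free_alg_simps zero_word_def)

section \<open>Computing in \<open>T\<close> with representatives\<close>

lemmas T_quot = algebra_ideal.rcos_ring_hom_quot_alg[OF T_ideal_algebra_ideal, folded T_alg_def]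

text \<open>Turns equality in \<open>T\<close> into membership in the ideal, the form in which
  \<iota> and \<pi> can be applied coefficientwise.\<close>

lemma T_coset_eq_iff:
  assumes "x \<in> carrier T_free" "y \<in> carrier T_free"
  shows "T_ideal d \<theta> \<theta>s +>\<^bsub>T_free\<^esub> x = T_ideal d \<theta> \<theta>s +>\<^bsub>T_free\<^esub> y
    \<longleftrightarrow> x - y \<in> T_ideal d \<theta> \<theta>s"
  using ring.quotient_eq_iff_same_a_r_cos[OF free_alg_ring
      algebra_ideal.axioms(1)[OF T_ideal_algebra_ideal] assms]
    words.monoid_alg_minus[of y x] assms(2)
  by (simp add: free_alg_def)

lemma T_coset_ops:
  fixes x y :: "generator word \<Rightarrow>\<^sub>0 'k::field"
  assumes x: "x \<in> carrier T_free"
  shows T_coset_add: "y \<in> carrier T_free \<Longrightarrow> (T_ideal d \<theta> \<theta>s +>\<^bsub>T_free\<^esub> x) \<oplus>\<^bsub>T_alg d \<theta> \<theta>s\<^esub>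
      (T_ideal d \<theta> \<theta>s +>\<^bsub>T_free\<^esub> y) = T_ideal d \<theta> \<theta>s +>\<^bsub>T_free\<^esub> (x + y)"
    and T_coset_mult: "y \<in> carrier T_free \<Longrightarrow> (T_ideal d \<theta> \<theta>s +>\<^bsub>T_free\<^esub> x) \<otimes>\<^bsub>T_alg d \<theta> \<theta>s\<^esub>
      (T_ideal d \<theta> \<theta>s +>\<^bsub>T_free\<^esub> y) = T_ideal d \<theta> \<theta>s +>\<^bsub>T_free\<^esub> (x * y)"
    and T_coset_smult: "c \<odot>\<^bsub>T_alg d \<theta> \<theta>s\<^esub> (T_ideal d \<theta> \<theta>s +>\<^bsub>T_free\<^esub> x)
      = T_ideal d \<theta> \<theta>s +>\<^bsub>T_free\<^esub> (scalar c * x)"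
proof -
  interpret h: ring_hom_ring T_free "T_alg d \<theta> \<theta>s" "(+>\<^bsub>T_free\<^esub>) (T_ideal d \<theta> \<theta>s)"
    by (rule T_quot)
  show "y \<in> carrier T_free \<Longrightarrow> (T_ideal d \<theta> \<theta>s +>\<^bsub>T_free\<^esub> x) \<oplus>\<^bsub>T_alg d \<theta> \<theta>s\<^esub>
      (T_ideal d \<theta> \<theta>s +>\<^bsub>T_free\<^esub> y) = T_ideal d \<theta> \<theta>s +>\<^bsub>T_free\<^esub> (x + y)"
    using h.hom_add[OF x] by (simp add: free_alg_simps(5))
  show "y \<in> carrier T_free \<Longrightarrow> (T_ideal d \<theta> \<theta>s +>\<^bsub>T_free\<^esub> x) \<otimes>\<^bsub>T_alg d \<theta> \<theta>s\<^esub>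
      (T_ideal d \<theta> \<theta>s +>\<^bsub>T_free\<^esub> y) = T_ideal d \<theta> \<theta>s +>\<^bsub>T_free\<^esub> (x * y)"
    using h.hom_mult[OF x] by (simp add: free_alg_simps(2))
  show "c \<odot>\<^bsub>T_alg d \<theta> \<theta>s\<^esub> (T_ideal d \<theta> \<theta>s +>\<^bsub>T_free\<^esub> x)
      = T_ideal d \<theta> \<theta>s +>\<^bsub>T_free\<^esub> (scalar c * x)"
    using algebra_ideal.quot_alg_smult[OF T_ideal_algebra_ideal x, folded T_alg_def]
    by (simp add: free_alg_simps(6))
qed

section \<open>Representatives for elements of the corner\<close>

lemma tau_Suc: "tau \<theta> (Suc i) = [:- \<theta> i, 1:] * tau \<theta> i"
  unfolding tau_def by (simp only: prod.lessThan_Suc mult.commute)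

text \<open>A representative of \<open>corner_tau\<close> in the free algebra: unlike the class, it
  can be mapped coefficientwise.\<close>

definition free_tau :: "(nat \<Rightarrow> 'k::field) \<Rightarrow> nat \<Rightarrow> generator word \<Rightarrow>\<^sub>0 'k" where
  "free_tau \<theta> i = letter (Es 0) *
    (\<Sum>k\<le>degree (tau \<theta> i). scalar (coeff (tau \<theta> i) k) * letter A ^ k) * letter (Es 0)"

lemma free_tau_closed: "free_tau \<theta> i \<in> carrier T_free"
  unfolding free_tau_def by (intro free_alg_closed free_alg_sum_closed T_gens_mem) auto

lemma corner_tau_eq: "corner_tau d \<theta> \<theta>s i = T_ideal d \<theta> \<theta>s +>\<^bsub>T_free\<^esub> free_tau \<theta> i"
proof -
  have pow: "x [^]\<^bsub>T_free\<^esub> (n::nat) = x ^ n" for x :: "generator word \<Rightarrow>\<^sub>0 'a" and n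
    using words.monoid_alg_pow[of x n] by (simp add: free_alg_def)
  have A: "letter A \<in> carrier T_free" and Es: "letter (Es 0) \<in> carrier T_free"
    by (auto intro: free_alg_closed T_gens_mem)
  have terms: "scalar (coeff p k) * letter A ^ k \<in> carrier T_free" for p :: "'a poly" and k
    by (intro free_alg_closed A)
  have "poly_eval T_free p (letter A) = (\<Sum>k\<le>degree p. scalar (coeff p k) * letter A ^ k)"
    for p :: "'a poly"
    using words.monoid_alg_finsum[of "{..degree p}" "\<lambda>k. scalar (coeff p k) * letter A ^ k"] terms
    by (simp add: poly_eval_def pow free_alg_simps(6)) (simp add: free_alg_def)
  then have "poly_eval (T_alg d \<theta> \<theta>s) p (T_ideal d \<theta> \<theta>s +>\<^bsub>T_free\<^esub> letter A)
      = T_ideal d \<theta> \<theta>s +>\<^bsub>T_free\<^esub> (\<Sum>k\<le>degree p. scalar (coeff p k) * letter A ^ k)" for p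
    using algebra_ideal.poly_eval_quot_alg[OF T_ideal_algebra_ideal A, folded T_alg_def] by metis
  moreover have "(\<Sum>k\<le>degree p. scalar (coeff p k) * letter A ^ k) \<in> carrier T_free"
    for p :: "'a poly"
    by (intro free_alg_sum_closed terms)
  ultimately show ?thesis
    unfolding corner_tau_def T_gen_def free_tau_def
    by (simp add: T_coset_mult Es free_alg_closed(3))
qed

text \<open>The projection from the free algebra onto \<open>T\<close> is surjective and
  multiplicative, so the middle factor may be taken in the free algebra.\<close>

lemma corner_T_carrier:
  fixes \<theta> \<theta>s :: "nat \<Rightarrow> 'k::field"
  shows "carrier (corner_T d \<theta> \<theta>s) =
    {T_ideal d \<theta> \<theta>s +>\<^bsub>T_free\<^esub> (letter (Es 0) * x * letter (Es 0)) | x. x \<in> carrier T_free}"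
proof -
  interpret h: ring_hom_ring T_free "T_alg d \<theta> \<theta>s" "(+>\<^bsub>T_free\<^esub>) (T_ideal d \<theta> \<theta>s)"
    by (rule T_quot)
  have Es: "(letter (Es 0) :: _ \<Rightarrow>\<^sub>0 'k) \<in> carrier T_free" by (intro free_alg_closed T_gens_mem) simp
  have "T_gen d \<theta> \<theta>s (Es 0) \<otimes>\<^bsub>T_alg d \<theta> \<theta>s\<^esub> (T_ideal d \<theta> \<theta>s +>\<^bsub>T_free\<^esub> x)
      \<otimes>\<^bsub>T_alg d \<theta> \<theta>s\<^esub> T_gen d \<theta> \<theta>s (Es 0)
      = T_ideal d \<theta> \<theta>s +>\<^bsub>T_free\<^esub> (letter (Es 0) * x * letter (Es 0))"
    if "x \<in> carrier T_free" for x
    using that Es by (simp add: T_gen_def T_coset_mult free_alg_closed(3))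
  then have "(\<lambda>X. T_gen d \<theta> \<theta>s (Es 0) \<otimes>\<^bsub>T_alg d \<theta> \<theta>s\<^esub> X \<otimes>\<^bsub>T_alg d \<theta> \<theta>s\<^esub> T_gen d \<theta> \<theta>s (Es 0)) `
      (+>\<^bsub>T_free\<^esub>) (T_ideal d \<theta> \<theta>s) ` carrier T_free
    = (\<lambda>x. T_ideal d \<theta> \<theta>s +>\<^bsub>T_free\<^esub> (letter (Es 0) * x * letter (Es 0))) ` carrier T_free"
    unfolding image_image by (rule image_cong[OF refl])
  moreover have "carrier (T_alg d \<theta> \<theta>s) = (+>\<^bsub>T_free\<^esub>) (T_ideal d \<theta> \<theta>s) ` carrier T_free"
    using algebra_ideal.quot_alg_carrierE[OF T_ideal_algebra_ideal, folded T_alg_def]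
    by (blast intro: h.hom_closed)
  ultimately show ?thesis
    by (simp add: corner_T_def corner_def setcompr_eq_image)
qed

section \<open>Homomorphisms from the polynomial algebra to the corner\<close>

context
  fixes \<theta> \<theta>s :: "nat \<Rightarrow> 'k::field" and \<mu>
  assumes \<mu>: "\<mu> \<in> alg_hom (poly_alg d) (corner_T d \<theta> \<theta>s)"
begin

lemma corner_hom_add:
  assumes "Poly_Mapping.keys f \<subseteq> exponents d" "Poly_Mapping.keys g \<subseteq> exponents d"
  shows "\<mu> (f + g) = \<mu> f \<oplus>\<^bsub>T_alg d \<theta> \<theta>s\<^esub> \<mu> g"
  using \<mu> assms
  by (auto simp: alg_hom_def ring_hom_def poly_alg_def monoid_alg_def corner_T_def corner_def)

lemma corner_hom_mult:
  assumes "Poly_Mapping.keys f \<subseteq> exponents d" "Poly_Mapping.keys g \<subseteq> exponents d"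
  shows "\<mu> (f * g) = \<mu> f \<otimes>\<^bsub>T_alg d \<theta> \<theta>s\<^esub> \<mu> g"
  using \<mu> assms
  by (auto simp: alg_hom_def ring_hom_def poly_alg_def monoid_alg_def corner_T_def corner_def)

text \<open>The corner inherits its operations from \<open>T\<close>, but its unit is the class of
  \<open>letter (Es 0)\<close>.\<close>

lemma corner_hom_one: "\<mu> 1 = T_ideal d \<theta> \<theta>s +>\<^bsub>T_free\<^esub> letter (Es 0)"
  using \<mu>
  by (auto simp: alg_hom_def ring_hom_def poly_alg_def monoid_alg_def corner_T_def corner_def T_gen_def)

lemma corner_hom_single:
  assumes "m \<in> exponents d"
  shows "\<mu> (Poly_Mapping.single m c) = c \<odot>\<^bsub>T_alg d \<theta> \<theta>s\<^esub> \<mu> (Poly_Mapping.single m 1)"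
proof -
  have "\<mu> (Poly_Mapping.single 0 c * f) = c \<odot>\<^bsub>T_alg d \<theta> \<theta>s\<^esub> \<mu> f"
    if "Poly_Mapping.keys f \<subseteq> exponents d" for f
    using \<mu> that by (auto simp: alg_hom_def poly_alg_def monoid_alg_def corner_T_def corner_def)
  from this[of "Poly_Mapping.single m 1"] assms show ?thesis
    by (simp add: mult_single)
qed

end

end

section \<open>Extension of scalars for \<open>T\<close>\<close>

locale T_extension = field_retraction \<iota> \<pi> for \<iota> :: "'k::field \<Rightarrow> 'f::field" and \<pi> +
  fixes d :: nat and \<theta> \<theta>s :: "nat \<Rightarrow> 'k"
begin

abbreviation TK :: "('k, generator word \<Rightarrow>\<^sub>0 'k) module" where "TK \<equiv> free_alg (T_gens d)"
abbreviation TF :: "('f, generator word \<Rightarrow>\<^sub>0 'f) module" where "TF \<equiv> free_alg (T_gens d)"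
abbreviation JK where "JK \<equiv> T_ideal d \<theta> \<theta>s"
abbreviation JF where "JF \<equiv> T_ideal d (\<iota> \<circ> \<theta>) (\<iota> \<circ> \<theta>s)"

lemma map_embed_letter [simp]: "Poly_Mapping.map \<iota> (letter g) = letter g"
  by (simp add: letter_def)

section \<open>Transfer of relations and ideals between K and F\<close>

lemma map_embed_closed: "x \<in> carrier TK \<Longrightarrow> Poly_Mapping.map \<iota> x \<in> carrier TF"
  and map_retract_closed: "y \<in> carrier TF \<Longrightarrow> Poly_Mapping.map \<pi> y \<in> carrier TK"
  using keys_map_subset by (fastforce simp: free_alg_simps)+

text \<open>Besides integers, the only coefficients in the relations are the \<theta> and \<theta>s
  parameters, and \<iota> carries these to the parameters over F.\<close>

lemma T_rels_embed: "T_rels d (\<iota> \<circ> \<theta>) (\<iota> \<circ> \<theta>s) = Poly_Mapping.map \<iota> ` T_rels d \<theta> \<theta>s"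
proof -
  \<comment> \<open>The two image rules move the image inside the families of relations, where the
    homomorphism laws of \<iota> apply.\<close>
  have image2: "h ` {f i j | i j. P i j} = {h (f i j) | i j. P i j}"
    for h :: "'x \<Rightarrow> 'y" and f and P :: "nat \<Rightarrow> nat \<Rightarrow> bool" by blast
  have image3: "h ` {f i j k | i j k. P i j k} = {h (f i j k) | i j k. P i j k}"
    for h :: "'x \<Rightarrow> 'y" and f and P :: "nat \<Rightarrow> nat \<Rightarrow> nat \<Rightarrow> bool" by blast
  show ?thesis
    unfolding T_rels_def image_Un image2 image3 image_insert image_empty
    by (simp add: embed.map_diff embed.map_sum map_embed_mult map_embed_power if_distrib
        cong: if_cong)
qed

text \<open>Coefficientwise \<iota> is a ring homomorphism, so the preimage of \<open>JF\<close> is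
  an ideal; it contains the relations over K and hence \<open>JK\<close>.\<close>

lemma map_embed_ideal:
  assumes "x \<in> JK"
  shows "Poly_Mapping.map \<iota> x \<in> JF"
proof -
  interpret K: ring TK by (rule free_alg_ring)
  interpret F: ring TF by (rule free_alg_ring)
  interpret h: ring_hom_ring TK TF "Poly_Mapping.map \<iota>"
    by (rule ring_hom_ringI[OF K.ring_axioms F.ring_axioms])
      (auto simp: map_embed_closed free_alg_simps(2-5) map_embed_mult embed.map_add)
  have "ideal JF TF" by (rule algebra_ideal.axioms(1)[OF T_ideal_algebra_ideal])
  from h.ideal_vimage[OF this]
  have "JK \<subseteq> {r \<in> carrier TK. Poly_Mapping.map \<iota> r \<in> JF}"
    unfolding T_ideal_def[of d \<theta> \<theta>s]
  proof (rule K.genideal_minimal)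
    show "T_rels d \<theta> \<theta>s \<subseteq> {r \<in> carrier TK. Poly_Mapping.map \<iota> r \<in> JF}"
      using T_rels_carrier[of d \<theta> \<theta>s] F.genideal_self[OF T_rels_carrier[of d "\<iota> \<circ> \<theta>" "\<iota> \<circ> \<theta>s"]]
      by (auto simp: T_rels_embed T_ideal_def)
  qed
  with assms show ?thesis by blast
qed

text \<open>Relations over F are images of relations \<open>r\<close> over K. By
  \<open>map_retract_mult\<close>, \<pi> sends a two-sided monomial multiple of such an image to a
  two-sided multiple of \<open>r\<close>, which lies in \<open>JK\<close>; minimality of
  \<open>JF\<close> does the rest.\<close>

lemma map_retract_ideal:
  assumes "y \<in> JF"
  shows "Poly_Mapping.map \<pi> y \<in> JK"
proof -
  interpret K: ring TK by (rule free_alg_ring)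
  interpret F: ring TF by (rule free_alg_ring)
  interpret JK: ideal JK TK by (rule algebra_ideal.axioms(1)[OF T_ideal_algebra_ideal])
  have JK_add: "a + b \<in> JK" if "a \<in> JK" "b \<in> JK" for a b
    using JK.a_closed[OF that] by (simp add: free_alg_simps(5))
  have JK_zero: "0 \<in> JK" using JK.zero_closed by (simp add: free_alg_simps(4))
  \<comment> \<open>Multiplying on both sides makes this an ideal at once, although \<open>\<pi>\<close> is not multiplicative.\<close>
  let ?I = "{y \<in> carrier TF. \<forall>u\<in>carrier TF. \<forall>v\<in>carrier TF. Poly_Mapping.map \<pi> (u * y * v) \<in> JK}"
  have "ideal ?I TF"
  proof (rule idealI[OF F.ring_axioms])
    show "subgroup ?I (add_monoid TF)"
    proof (rule group.subgroupI[OF F.a_group])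
      show "inv\<^bsub>add_monoid TF\<^esub> a \<in> ?I" if "a \<in> ?I" for a
      proof -
        have a: "a \<in> carrier TF" using that by simp
        have "inv\<^bsub>add_monoid TF\<^esub> a = \<ominus>\<^bsub>TF\<^esub> a" by (simp add: a_inv_def)
        also have "\<dots> = - a"
          by (rule F.minus_equality[OF _ a]) (use a in \<open>auto simp: free_alg_simps in_keys_iff\<close>)
        finally have inv: "inv\<^bsub>add_monoid TF\<^esub> a = - a" .
        have "Poly_Mapping.map \<pi> (u * - a * v) \<in> JK" if "u \<in> carrier TF" "v \<in> carrier TF" for u v
        proof -
          \<comment> \<open>The sign is moved to \<open>u\<close>, so that the property of
            \<open>a\<close> can be used at \<open>- u\<close>.\<close>
          have "- u \<in> carrier TF" using that(1) by (auto simp: free_alg_simps in_keys_iff)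
          then have "Poly_Mapping.map \<pi> (- u * a * v) \<in> JK" using \<open>a \<in> ?I\<close> that(2) by blast
          then show ?thesis by simp
        qed
        moreover have "- a \<in> carrier TF" using a by (auto simp: free_alg_simps in_keys_iff)
        ultimately show ?thesis unfolding inv by blast
      qed
      show "?I \<noteq> {}" using JK_zero free_alg_closed(5) by force
      show "a \<otimes>\<^bsub>add_monoid TF\<^esub> b \<in> ?I" if "a \<in> ?I" "b \<in> ?I" for a b
        using that by (auto simp: free_alg_simps(5) free_alg_closed ring_distribs retract.map_add JK_add)
    qed auto
    \<comment> \<open>A factor on either side of \<open>a\<close> is absorbed into the multiplier on
      that side.\<close>
    show "x \<otimes>\<^bsub>TF\<^esub> a \<in> ?I" if "a \<in> ?I" "x \<in> carrier TF" for a x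
      using that free_alg_closed(3)[of _ d x] by (auto simp: free_alg_simps(2) mult.assoc[symmetric] free_alg_closed(3))
    show "a \<otimes>\<^bsub>TF\<^esub> x \<in> ?I" if "a \<in> ?I" "x \<in> carrier TF" for a x
      using that free_alg_closed(3)[of x d] by (auto simp: free_alg_simps(2) mult.assoc free_alg_closed(3))
  qed
  moreover have "T_rels d (\<iota> \<circ> \<theta>) (\<iota> \<circ> \<theta>s) \<subseteq> ?I"
  proof
    fix y assume y: "y \<in> T_rels d (\<iota> \<circ> \<theta>) (\<iota> \<circ> \<theta>s)"
    then obtain r where r: "r \<in> T_rels d \<theta> \<theta>s" "y = Poly_Mapping.map \<iota> r"
      by (auto simp: T_rels_embed)
    have rJ: "r \<in> JK"
      using r(1) K.genideal_self[OF T_rels_carrier[of d \<theta> \<theta>s]] by (auto simp: T_ideal_def)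
    have monomials: "Poly_Mapping.map \<pi> (Poly_Mapping.single a b * y * Poly_Mapping.single a' b') \<in> JK"
      if "a \<in> T_words d" "a' \<in> T_words d" for a b a' b'
      using JK.I_r_closed[OF JK.I_l_closed[OF rJ free_alg_closed(7)[OF that(1), of "\<pi> (b * b')"]]
          free_alg_closed(7)[OF that(2), of 1]]
      by (simp add: r(2) map_retract_mult free_alg_simps(2))
    \<comment> \<open>Additivity of \<pi> and distributivity reduce \<open>v\<close>, and then
      \<open>u\<close>, to monomials.\<close>
    have "Poly_Mapping.map \<pi> (u * y * v) \<in> JK"
      if u: "Poly_Mapping.keys u \<subseteq> T_words d" and v: "Poly_Mapping.keys v \<subseteq> T_words d" for u v
      using v
    proof (induction v rule: keys_subset_induct)
      case (single m c)
      show ?case using u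
        by (induction u rule: keys_subset_induct)
          (simp_all add: JK_zero retract.map_add JK_add ring_distribs monomials[OF _ single])
    qed (simp_all add: JK_zero retract.map_add JK_add ring_distribs)
    then show "y \<in> ?I" using subsetD[OF T_rels_carrier y] by (auto simp: free_alg_simps(1))
  qed
  ultimately have "JF \<subseteq> ?I"
    unfolding T_ideal_def[of d "\<iota> \<circ> \<theta>"] by (rule F.genideal_minimal)
  with assms have "y \<in> ?I" by blast
  \<comment> \<open>Both multipliers are specialised to 1.\<close>
  then have "Poly_Mapping.map \<pi> (1 * y * 1) \<in> JK" using free_alg_closed(6) by blast
  then show ?thesis by simp
qed

text \<open>By the recursion \<open>tau_Suc\<close>, \<iota> commutes with taking the coefficients
  of \<open>tau\<close>. Injectivity of \<iota> preserves the degree, so both sums have the same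
  range.\<close>

lemma map_embed_free_tau: "Poly_Mapping.map \<iota> (free_tau \<theta> i) = free_tau (\<iota> \<circ> \<theta>) i"
proof -
  have coeff: "coeff (tau (\<iota> \<circ> \<theta>) i) k = \<iota> (coeff (tau \<theta> i) k)" for k
  proof (induction i arbitrary: k)
    case 0
    then show ?case by (simp add: tau_def coeff_1)
  next
    case (Suc i)
    then show ?case
      by (cases k) (simp_all add: tau_Suc embed_diff embed_mult embed_uminus)
  qed
  moreover have "\<iota> x = 0 \<longleftrightarrow> x = 0" for x
    using embed_eq_iff[of x 0] by simp
  ultimately have "degree (tau (\<iota> \<circ> \<theta>) i) = degree (tau \<theta> i)"
    by (simp add: degree_def)
  with coeff show ?thesis
    by (simp add: free_tau_def map_embed_mult embed.map_sum map_embed_power)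
qed

section \<open>Comparison of the two homomorphisms and descent\<close>

context
  fixes \<mu>K :: "((nat \<Rightarrow>\<^sub>0 nat) \<Rightarrow>\<^sub>0 'k) \<Rightarrow> (generator word \<Rightarrow>\<^sub>0 'k) set"
    and \<mu>F :: "((nat \<Rightarrow>\<^sub>0 nat) \<Rightarrow>\<^sub>0 'f) \<Rightarrow> (generator word \<Rightarrow>\<^sub>0 'f) set"
  assumes \<mu>K: "\<mu>K \<in> alg_hom (poly_alg d) (corner_T d \<theta> \<theta>s)"
    and \<mu>K_var: "\<And>i. i \<in> {1..d} \<Longrightarrow> \<mu>K (pvar i) = corner_tau d \<theta> \<theta>s i"
    and \<mu>F: "\<mu>F \<in> alg_hom (poly_alg d) (corner_T d (\<iota> \<circ> \<theta>) (\<iota> \<circ> \<theta>s))"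
    and \<mu>F_var: "\<And>i. i \<in> {1..d} \<Longrightarrow> \<mu>F (pvar i) = corner_tau d (\<iota> \<circ> \<theta>) (\<iota> \<circ> \<theta>s) i"
begin

text \<open>A single \<open>x\<close> over K represents both images of a monomial:
  \<open>letter (Es 0)\<close> for the monomial 1, \<open>free_tau\<close> for a variable, and
  products of these in general.\<close>

lemma monomial_lift:
  assumes "m \<in> exponents d"
  shows "\<exists>x\<in>carrier TK. \<mu>K (Poly_Mapping.single m 1) = JK +>\<^bsub>TK\<^esub> x
    \<and> \<mu>F (Poly_Mapping.single m 1) = JF +>\<^bsub>TF\<^esub> Poly_Mapping.map \<iota> x"
  (is "?P m")
proof -
  have zero: "?P 0"
    using corner_hom_one[OF \<mu>K] corner_hom_one[OF \<mu>F]
    \<comment> \<open>Unification eta-expands \<open>\<iota> \<circ> \<theta>\<close> in the goal, which \<open>comp_apply\<close> would then unfold there only.\<close>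
    by (intro bexI[of _ "letter (Es 0)"]) (simp_all add: T_gens_mem free_alg_closed(9) del: comp_apply)
  have add: "?P (m + n)" if mn: "m \<in> exponents d" "n \<in> exponents d" "?P m" "?P n" for m n
  proof -
    from mn obtain x y where x: "x \<in> carrier TK" "\<mu>K (Poly_Mapping.single m 1) = JK +>\<^bsub>TK\<^esub> x"
        "\<mu>F (Poly_Mapping.single m 1) = JF +>\<^bsub>TF\<^esub> Poly_Mapping.map \<iota> x"
      and y: "y \<in> carrier TK" "\<mu>K (Poly_Mapping.single n 1) = JK +>\<^bsub>TK\<^esub> y"
        "\<mu>F (Poly_Mapping.single n 1) = JF +>\<^bsub>TF\<^esub> Poly_Mapping.map \<iota> y" by blast
    have "Poly_Mapping.keys (Poly_Mapping.single m (1::'k)) \<subseteq> exponents d"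
      "Poly_Mapping.keys (Poly_Mapping.single n (1::'k)) \<subseteq> exponents d"
      "Poly_Mapping.keys (Poly_Mapping.single m (1::'f)) \<subseteq> exponents d"
      "Poly_Mapping.keys (Poly_Mapping.single n (1::'f)) \<subseteq> exponents d"
      using mn by simp_all
    note corner_hom_mult[OF \<mu>K this(1,2)] corner_hom_mult[OF \<mu>F this(3,4)]
    with x y show ?thesis
      by (intro bexI[of _ "x * y"])
        (simp_all add: mult_single T_coset_mult map_embed_closed map_embed_mult free_alg_closed(3) del: comp_apply)
  qed
  have single_mem: "Poly_Mapping.single i n \<in> exponents d" if "i \<in> {1..d}" for i n
    using that by auto
  from assms have "Poly_Mapping.keys m \<subseteq> {1..d}" by simp
  then show ?thesis
  \<comment> \<open>Here the exponent vector itself is decomposed: its single terms are powers of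
    one variable, handled by induction on the exponent, and sums of vectors are products of
    monomials.\<close>
  proof (induction m rule: keys_subset_induct)
    case (single i n)
    have one: "?P (Poly_Mapping.single i 1)"
      using \<mu>K_var[OF single] \<mu>F_var[OF single]
      by (intro bexI[of _ "free_tau \<theta> i"])
        (simp_all add: pvar_def corner_tau_eq map_embed_free_tau free_tau_closed del: comp_apply)
    show ?case
    proof (induction n)
      case (Suc n)
      have "Poly_Mapping.single i (Suc n) = Poly_Mapping.single i n + Poly_Mapping.single i 1"
        by (simp flip: single_add)
      with add[OF single_mem[OF single] single_mem[OF single] Suc one] show ?case by metis
    qed (simp add: zero[simplified])
  qed (use zero add in \<open>simp_all\<close>)
qed

text \<open>K-linear extension of \<open>monomial_lift\<close>: passing from a monomial to its
  \<open>c\<close>-fold replaces \<open>x\<close> by \<open>scalar c * x\<close>. This compatibility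
  of \<iota> with both homomorphisms yields injectivity.\<close>

lemma embed_lift:
  assumes "Poly_Mapping.keys f \<subseteq> exponents d"
  shows "\<exists>x\<in>carrier TK. \<mu>K f = JK +>\<^bsub>TK\<^esub> x
    \<and> \<mu>F (Poly_Mapping.map \<iota> f) = JF +>\<^bsub>TF\<^esub> Poly_Mapping.map \<iota> x"
  (is "?P f")
proof -
  have single: "?P (Poly_Mapping.single m c)" if m: "m \<in> exponents d" for m c
  proof -
    from monomial_lift[OF m] obtain x where x: "x \<in> carrier TK"
      "\<mu>K (Poly_Mapping.single m 1) = JK +>\<^bsub>TK\<^esub> x"
      "\<mu>F (Poly_Mapping.single m 1) = JF +>\<^bsub>TF\<^esub> Poly_Mapping.map \<iota> x" by blast
    then show ?thesis
      using corner_hom_single[OF \<mu>K m, of c] corner_hom_single[OF \<mu>F m, of "\<iota> c"]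
      by (intro bexI[of _ "scalar c * x"])
        (simp_all add: T_coset_smult map_embed_closed map_embed_mult free_alg_closed(3,8) del: comp_apply)
  qed
  from assms show ?thesis
  proof (induction f rule: keys_subset_induct)
    case zero
    \<comment> \<open>The zero polynomial is the monomial 1 with coefficient 0.\<close>
    show ?case using single[of 0 0] by simp
  next
    case (add f g)
    then obtain x y where x: "x \<in> carrier TK" "\<mu>K f = JK +>\<^bsub>TK\<^esub> x"
        "\<mu>F (Poly_Mapping.map \<iota> f) = JF +>\<^bsub>TF\<^esub> Poly_Mapping.map \<iota> x"
      and y: "y \<in> carrier TK" "\<mu>K g = JK +>\<^bsub>TK\<^esub> y"
        "\<mu>F (Poly_Mapping.map \<iota> g) = JF +>\<^bsub>TF\<^esub> Poly_Mapping.map \<iota> y" by blast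
    note corner_hom_add[OF \<mu>K add(1,2)] corner_hom_add[OF \<mu>F
        keys_map_subset[THEN subset_trans, OF add(1)] keys_map_subset[THEN subset_trans, OF add(2)]]
    with x y show ?case
      by (intro bexI[of _ "x + y"])
        (simp_all add: T_coset_add map_embed_closed embed.map_add free_alg_closed(1) del: comp_apply)
  qed (rule single)
qed

text \<open>The counterpart for \<pi>, used for surjectivity: \<open>c\<close> times a monomial is
  represented over F by \<open>c\<close> times the embedded \<open>x\<close>, which \<pi> sends to
  \<open>\<pi> c\<close> times \<open>x\<close>.\<close>

lemma retract_lift:
  assumes "Poly_Mapping.keys g \<subseteq> exponents d"
  shows "\<exists>y\<in>carrier TF. \<mu>F g = JF +>\<^bsub>TF\<^esub> y
    \<and> \<mu>K (Poly_Mapping.map \<pi> g) = JK +>\<^bsub>TK\<^esub> Poly_Mapping.map \<pi> y"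
  (is "?P g")
proof -
  have single: "?P (Poly_Mapping.single m c)" if m: "m \<in> exponents d" for m c
  proof -
    from monomial_lift[OF m] obtain x where x: "x \<in> carrier TK"
      "\<mu>K (Poly_Mapping.single m 1) = JK +>\<^bsub>TK\<^esub> x"
      "\<mu>F (Poly_Mapping.single m 1) = JF +>\<^bsub>TF\<^esub> Poly_Mapping.map \<iota> x" by blast
    then show ?thesis
      using corner_hom_single[OF \<mu>K m, of "\<pi> c"] corner_hom_single[OF \<mu>F m, of c]
      by (intro bexI[of _ "scalar c * Poly_Mapping.map \<iota> x"])
        (simp_all add: T_coset_smult map_embed_closed map_retract_mult_left free_alg_closed(3,8) del: comp_apply)
  qed
  from assms show ?thesis
  proof (induction g rule: keys_subset_induct)
    case zero
    show ?case using single[of 0 0] by simp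
  next
    case (add f g)
    then obtain x y where x: "x \<in> carrier TF" "\<mu>F f = JF +>\<^bsub>TF\<^esub> x"
        "\<mu>K (Poly_Mapping.map \<pi> f) = JK +>\<^bsub>TK\<^esub> Poly_Mapping.map \<pi> x"
      and y: "y \<in> carrier TF" "\<mu>F g = JF +>\<^bsub>TF\<^esub> y"
        "\<mu>K (Poly_Mapping.map \<pi> g) = JK +>\<^bsub>TK\<^esub> Poly_Mapping.map \<pi> y" by blast
    note corner_hom_add[OF \<mu>F add(1,2)] corner_hom_add[OF \<mu>K
        keys_map_subset[THEN subset_trans, OF add(1)] keys_map_subset[THEN subset_trans, OF add(2)]]
    with x y show ?case
      by (intro bexI[of _ "x + y"])
        (simp_all add: T_coset_add map_retract_closed retract.map_add free_alg_closed(1) del: comp_apply)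
  qed (rule single)
qed

text \<open>Equal images over K have representatives that differ by an element of \<open>JK\<close>;
  \<iota> moves the difference into \<open>JF\<close>, so the images over F agree, and \<pi>
  recovers \<open>f = g\<close>.\<close>

lemma inj_descent:
  assumes "inj_on \<mu>F (carrier (poly_alg d))"
  shows "inj_on \<mu>K (carrier (poly_alg d))"
proof (rule inj_onI)
  fix f g assume "f \<in> carrier (poly_alg d)" "g \<in> carrier (poly_alg d)" and eq: "\<mu>K f = \<mu>K g"
  then have fg: "Poly_Mapping.keys f \<subseteq> exponents d" "Poly_Mapping.keys g \<subseteq> exponents d"
    by (simp_all add: poly_alg_def monoid_alg_def)
  from embed_lift[OF fg(1)] obtain x where x: "x \<in> carrier TK" "\<mu>K f = JK +>\<^bsub>TK\<^esub> x"
        "\<mu>F (Poly_Mapping.map \<iota> f) = JF +>\<^bsub>TF\<^esub> Poly_Mapping.map \<iota> x" by blast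
  from embed_lift[OF fg(2)] obtain y where y: "y \<in> carrier TK" "\<mu>K g = JK +>\<^bsub>TK\<^esub> y"
        "\<mu>F (Poly_Mapping.map \<iota> g) = JF +>\<^bsub>TF\<^esub> Poly_Mapping.map \<iota> y" by blast
  have "x - y \<in> JK"
    using eq x(2) y(2) T_coset_eq_iff[OF x(1) y(1)] by metis
  then have "\<mu>F (Poly_Mapping.map \<iota> f) = \<mu>F (Poly_Mapping.map \<iota> g)"
    using x y map_embed_ideal[of "x - y"] by (simp add: T_coset_eq_iff map_embed_closed flip: embed.map_diff)
  moreover have "Poly_Mapping.map \<iota> f \<in> carrier (poly_alg d)"
    "Poly_Mapping.map \<iota> g \<in> carrier (poly_alg d)"
    using fg keys_map_subset[of \<iota> f] keys_map_subset[of \<iota> g]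
    by (auto simp: poly_alg_def monoid_alg_def)
  ultimately have "Poly_Mapping.map \<iota> f = Poly_Mapping.map \<iota> g"
    using assms by (blast dest: inj_onD)
  then show "f = g" by (metis map_retract_embed)
qed

text \<open>A corner element over K is embedded into the corner over F, written there as
  \<open>\<mu>F g\<close>, and retracted: the preimage over K is \<pi> applied to
  \<open>g\<close>.\<close>

lemma surj_descent:
  assumes "carrier (corner_T d (\<iota> \<circ> \<theta>) (\<iota> \<circ> \<theta>s)) \<subseteq> \<mu>F ` carrier (poly_alg d)"
  shows "carrier (corner_T d \<theta> \<theta>s) \<subseteq> \<mu>K ` carrier (poly_alg d)"
proof
  fix Y assume "Y \<in> carrier (corner_T d \<theta> \<theta>s)"
  then obtain x where x: "x \<in> carrier TK"
    and Y: "Y = JK +>\<^bsub>TK\<^esub> (letter (Es 0) * x * letter (Es 0))"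
    by (auto simp: corner_T_carrier)
  let ?z = "letter (Es 0) * x * letter (Es 0)"
  have z: "?z \<in> carrier TK"
    using x by (intro free_alg_closed T_gens_mem) auto
  \<comment> \<open>Since \<iota> fixes letters and is multiplicative, the embedded
    \<open>?z\<close> still has the shape of a corner element.\<close>
  have "JF +>\<^bsub>TF\<^esub> Poly_Mapping.map \<iota> ?z \<in> carrier (corner_T d (\<iota> \<circ> \<theta>) (\<iota> \<circ> \<theta>s))"
    using map_embed_closed[OF x] by (auto simp: corner_T_carrier map_embed_mult)
  with assms obtain g where g: "g \<in> carrier (poly_alg d)"
    "\<mu>F g = JF +>\<^bsub>TF\<^esub> Poly_Mapping.map \<iota> ?z" by (metis (no_types, lifting) imageE subsetD)
  then have keys: "Poly_Mapping.keys g \<subseteq> exponents d"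
    by (simp add: poly_alg_def monoid_alg_def)
  from retract_lift[OF this] obtain y where y: "y \<in> carrier TF" "\<mu>F g = JF +>\<^bsub>TF\<^esub> y"
    "\<mu>K (Poly_Mapping.map \<pi> g) = JK +>\<^bsub>TK\<^esub> Poly_Mapping.map \<pi> y" by blast
  \<comment> \<open>Both terms represent \<open>\<mu>F g\<close>. Applying \<pi> returns
    \<open>?z\<close> from the first and a representative of the image of the retracted
    \<open>g\<close> from the second.\<close>
  have "Poly_Mapping.map \<iota> ?z - y \<in> JF"
    using g(2) y T_coset_eq_iff[OF map_embed_closed[OF z] y(1)] by metis
  from map_retract_ideal[OF this] have "?z - Poly_Mapping.map \<pi> y \<in> JK"
    by (simp add: retract.map_diff)
  then have "Y = \<mu>K (Poly_Mapping.map \<pi> g)"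
    using Y y(3) T_coset_eq_iff[OF z map_retract_closed[OF y(1)]] by metis
  moreover have "Poly_Mapping.map \<pi> g \<in> carrier (poly_alg d)"
    using keys keys_map_subset[of \<pi> g] by (auto simp: poly_alg_def monoid_alg_def)
  ultimately show "Y \<in> \<mu>K ` carrier (poly_alg d)" by blast
qed

end

end

theorem theorem5p2:
  fixes d :: nat
    and \<theta> \<theta>s :: "nat \<Rightarrow> 'k::field"
    and \<iota> :: "'k \<Rightarrow> 'f::field"
    and \<mu>K :: "((nat \<Rightarrow>\<^sub>0 nat) \<Rightarrow>\<^sub>0 'k) \<Rightarrow> (generator word \<Rightarrow>\<^sub>0 'k) set"
    and \<mu>F :: "((nat \<Rightarrow>\<^sub>0 nat) \<Rightarrow>\<^sub>0 'f) \<Rightarrow> (generator word \<Rightarrow>\<^sub>0 'f) set"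
  assumes distinct:
      "\<forall>i\<le>d. \<forall>j\<le>d. i \<noteq> j \<longrightarrow> \<theta> i \<noteq> \<theta> j \<and> \<theta>s i \<noteq> \<theta>s j"
    and recurrent:
      "\<exists>\<beta>. \<forall>i. 2 \<le> i \<and> i < d \<longrightarrow>
        (\<theta> (i - 2) - \<theta> (i + 1)) / (\<theta> (i - 1) - \<theta> i) = \<beta> \<and>
        (\<theta>s (i - 2) - \<theta>s (i + 1)) / (\<theta>s (i - 1) - \<theta>s i) = \<beta>"
    and extension: "field_embedding \<iota>"
    and muK_hom: "\<mu>K \<in> alg_hom (poly_alg d) (corner_T d \<theta> \<theta>s)"
    and muK_var: "\<forall>i\<in>{1..d}. \<mu>K (pvar i) = corner_tau d \<theta> \<theta>s i"
    and muF_hom: "\<mu>F \<in> alg_hom (poly_alg d) (corner_T d (\<iota> \<circ> \<theta>) (\<iota> \<circ> \<theta>s))"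
    and muF_var: "\<forall>i\<in>{1..d}. \<mu>F (pvar i) = corner_tau d (\<iota> \<circ> \<theta>) (\<iota> \<circ> \<theta>s) i"
    and muF_iso: "\<mu>F \<in> alg_iso (poly_alg d) (corner_T d (\<iota> \<circ> \<theta>) (\<iota> \<circ> \<theta>s))"
  shows "\<mu>K \<in> alg_iso (poly_alg d) (corner_T d \<theta> \<theta>s)"
proof -
  \<comment> \<open>Any linear retraction will do, since the conclusion does not depend on the
    choice.\<close>
  obtain \<pi> where "field_retraction \<iota> \<pi>"
    using field_retraction_exists[OF extension] .
  then interpret T_extension \<iota> \<pi> d \<theta> \<theta>s by (rule T_extension.intro)
  have var: "\<And>i. i \<in> {1..d} \<Longrightarrow> \<mu>K (pvar i) = corner_tau d \<theta> \<theta>s i"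
    "\<And>i. i \<in> {1..d} \<Longrightarrow> \<mu>F (pvar i) = corner_tau d (\<iota> \<circ> \<theta>) (\<iota> \<circ> \<theta>s) i"
    using muK_var muF_var by auto
  have "inj_on \<mu>F (carrier (poly_alg d))"
    and "\<mu>F ` carrier (poly_alg d) = carrier (corner_T d (\<iota> \<circ> \<theta>) (\<iota> \<circ> \<theta>s))"
    using muF_iso by (auto simp: alg_iso_def bij_betw_def)
  then have "inj_on \<mu>K (carrier (poly_alg d))"
    and "carrier (corner_T d \<theta> \<theta>s) \<subseteq> \<mu>K ` carrier (poly_alg d)"
    using inj_descent[OF muK_hom var(1) muF_hom var(2)]
      surj_descent[OF muK_hom var(1) muF_hom var(2)] by simp_all
  moreover have "\<mu>K ` carrier (poly_alg d) \<subseteq> carrier (corner_T d \<theta> \<theta>s)"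
    using muK_hom by (auto simp: alg_hom_def ring_hom_def)
  ultimately show ?thesis
    using muK_hom by (simp add: alg_iso_def bij_betw_def subset_antisym)
qed

end
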